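(* Let $K$ be a field, $E=(E^0,E^1,s,r)$ a graph, and $\sigma=(\sigma_0,\sigma_1)$ an automorphism of $E$. Then the assignment $$\sigma(v)=\sigma_0(v)\quad (v\in E^0),\qquad \sigma(e)=\sigma_1(e),\qquad \sigma(e^* )=\sigma_1(e)^*\quad (e\in E^1)$$ extends to a graded $K$-algebra automorphism of the Leavitt path algebra $L_K(E)$. In particular, if $E^0$ is finite, then this automorphism is unital.
   Context: A graph $E=(E^0,E^1,s,r)$ consists of disjoint sets $E^0$ (vertices) and $E^1$ (edges), of arbitrary cardinality, and maps $s,r\colon E^1\to E^0$ (source and range). A regular vertex is $v\in E^0$ with $0<|s^{-1}(v)|<\infty$. An automorphism of $E$ is a pair $\sigma=(\sigma_0,\sigma_1)$ of bijections $\sigma_0\colon E^0\to E^0$, $\sigma_1\colon E^1\to E^1$ with $s\circ\sigma_1=\sigma_0\circ s$ and $r\circ\sigma_1=\sigma_0\circ r$. The Leavitt path algebra $L_K(E)$ is the (not necessarily unital) associative $K$-algebra generated by $E^0\cup E^1\cup\{e^*\mid e\in E^1\}$ subject to, for all $v,w\in E^0$, $e,f\in E^1$: (1) $vw=\delta_{v,w}w$; (2) $s(e)e=e=er(e)$ and $e^*s(e)=e^*=r(e)e^*$; (3) $e^*f=\delta_{e,f}r(e)$; (4) $v=\sum_{e\in s^{-1}(v)}ee^*$ for every regular vertex $v$. It is $\mathbb Z$-graded by $\deg v=0$, $\deg e=1$, $\deg e^*=-1$. If $E^0$ is finite, its identity is $\sum_{v\in E^0}v$. *)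

theory Defs
  imports "Graph_Theory.Digraph" "HOL-Library.Poly_Mapping"
begin

section \<open>Graph automorphisms\<close>

text \<open>A graph is a \<^locale>\<open>wf_digraph\<close>: a directed multigraph with loops allowed and no finiteness
  assumption, \<^const>\<open>tail\<close> being the source map and \<^const>\<open>head\<close> the range map.\<close>

definition graph_automorphism :: "('v,'e) pre_digraph \<Rightarrow> ('v \<Rightarrow> 'v) \<Rightarrow> ('e \<Rightarrow> 'e) \<Rightarrow> bool" where
  "graph_automorphism E \<sigma>0 \<sigma>1 \<longleftrightarrow>
     bij_betw \<sigma>0 (verts E) (verts E) \<and>
     bij_betw \<sigma>1 (arcs E) (arcs E) \<and>
     (\<forall>e\<in>arcs E. tail E (\<sigma>1 e) = \<sigma>0 (tail E e)) \<and>
     (\<forall>e\<in>arcs E. head E (\<sigma>1 e) = \<sigma>0 (head E e))"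

definition regular_vertex :: "('v,'e) pre_digraph \<Rightarrow> 'v \<Rightarrow> bool" where
  "regular_vertex E v \<longleftrightarrow> v \<in> verts E \<and> out_arcs E v \<noteq> {} \<and> finite (out_arcs E v)"


section \<open>Not necessarily unital associative algebras\<close>

record ('k,'a) algebra_struct =
  elems :: "'a set"
  add :: "'a \<Rightarrow> 'a \<Rightarrow> 'a"
  zer :: "'a"
  mul :: "'a \<Rightarrow> 'a \<Rightarrow> 'a"
  scl :: "'k \<Rightarrow> 'a \<Rightarrow> 'a"

locale nonunital_algebra =
  fixes A :: "('k::field,'a) algebra_struct"
  assumes add_closed: "\<lbrakk>x \<in> elems A; y \<in> elems A\<rbrakk> \<Longrightarrow> add A x y \<in> elems A"
    and zer_closed: "zer A \<in> elems A"
    and mul_closed: "\<lbrakk>x \<in> elems A; y \<in> elems A\<rbrakk> \<Longrightarrow> mul A x y \<in> elems A"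
    and scl_closed: "x \<in> elems A \<Longrightarrow> scl A c x \<in> elems A"
    and add_assoc: "\<lbrakk>x \<in> elems A; y \<in> elems A; z \<in> elems A\<rbrakk>
          \<Longrightarrow> add A (add A x y) z = add A x (add A y z)"
    and add_commute: "\<lbrakk>x \<in> elems A; y \<in> elems A\<rbrakk> \<Longrightarrow> add A x y = add A y x"
    and add_zer: "x \<in> elems A \<Longrightarrow> add A x (zer A) = x"
    and add_inverse: "x \<in> elems A \<Longrightarrow> \<exists>y\<in>elems A. add A x y = zer A"
    and mul_assoc: "\<lbrakk>x \<in> elems A; y \<in> elems A; z \<in> elems A\<rbrakk>
          \<Longrightarrow> mul A (mul A x y) z = mul A x (mul A y z)"
    and mul_add_left: "\<lbrakk>x \<in> elems A; y \<in> elems A; z \<in> elems A\<rbrakk>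
          \<Longrightarrow> mul A (add A x y) z = add A (mul A x z) (mul A y z)"
    and mul_add_right: "\<lbrakk>x \<in> elems A; y \<in> elems A; z \<in> elems A\<rbrakk>
          \<Longrightarrow> mul A x (add A y z) = add A (mul A x y) (mul A x z)"
    and scl_add_right: "\<lbrakk>x \<in> elems A; y \<in> elems A\<rbrakk>
          \<Longrightarrow> scl A c (add A x y) = add A (scl A c x) (scl A c y)"
    and scl_add_left: "x \<in> elems A \<Longrightarrow> scl A (c + d) x = add A (scl A c x) (scl A d x)"
    and scl_scl: "x \<in> elems A \<Longrightarrow> scl A c (scl A d x) = scl A (c * d) x"
    and scl_one: "x \<in> elems A \<Longrightarrow> scl A 1 x = x"
    and scl_mul_left: "\<lbrakk>x \<in> elems A; y \<in> elems A\<rbrakk>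
          \<Longrightarrow> mul A (scl A c x) y = scl A c (mul A x y)"
    and scl_mul_right: "\<lbrakk>x \<in> elems A; y \<in> elems A\<rbrakk>
          \<Longrightarrow> mul A x (scl A c y) = scl A c (mul A x y)"

definition algebra_hom ::
    "('k::field,'a) algebra_struct \<Rightarrow> ('k,'b) algebra_struct \<Rightarrow> ('a \<Rightarrow> 'b) \<Rightarrow> bool" where
  "algebra_hom A B \<phi> \<longleftrightarrow>
     (\<forall>x\<in>elems A. \<phi> x \<in> elems B) \<and>
     (\<forall>x\<in>elems A. \<forall>y\<in>elems A. \<phi> (add A x y) = add B (\<phi> x) (\<phi> y)) \<and>
     (\<forall>x\<in>elems A. \<forall>y\<in>elems A. \<phi> (mul A x y) = mul B (\<phi> x) (\<phi> y)) \<and>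
     (\<forall>c. \<forall>x\<in>elems A. \<phi> (scl A c x) = scl B c (\<phi> x))"

definition algebra_automorphism :: "('k::field,'a) algebra_struct \<Rightarrow> ('a \<Rightarrow> 'a) \<Rightarrow> bool" where
  "algebra_automorphism A \<phi> \<longleftrightarrow> algebra_hom A A \<phi> \<and> bij_betw \<phi> (elems A) (elems A)"

text \<open>The equality \<open>\<phi> ` gr n = gr n\<close> says that both \<open>\<phi>\<close> and its inverse preserve degrees.\<close>

definition graded_algebra_automorphism ::
    "('k::field,'a) algebra_struct \<Rightarrow> (int \<Rightarrow> 'a set) \<Rightarrow> ('a \<Rightarrow> 'a) \<Rightarrow> bool" where
  "graded_algebra_automorphism A gr \<phi> \<longleftrightarrow> algebra_automorphism A \<phi> \<and> (\<forall>n. \<phi> ` gr n = gr n)"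

definition is_identity :: "('k::field,'a) algebra_struct \<Rightarrow> 'a \<Rightarrow> bool" where
  "is_identity A u \<longleftrightarrow> u \<in> elems A \<and> (\<forall>x\<in>elems A. mul A u x = x \<and> mul A x u = x)"

definition unital_map ::
    "('k::field,'a) algebra_struct \<Rightarrow> ('k,'b) algebra_struct \<Rightarrow> ('a \<Rightarrow> 'b) \<Rightarrow> bool" where
  "unital_map A B \<phi> \<longleftrightarrow> (\<exists>u. is_identity A u \<and> is_identity B (\<phi> u))"


section \<open>Free algebras\<close>

text \<open>Words form the free monoid, written additively because \<^typ>\<open>'a \<Rightarrow>\<^sub>0 'b\<close> is the monoid algebra
  of an additively written (here noncommutative) monoid.\<close>

datatype 'g word = Word (letters: "'g list")

instantiation word :: (type) monoid_add
begin

definition zero_word :: "'a word" where "zero_word = Word []"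

definition plus_word :: "'a word \<Rightarrow> 'a word \<Rightarrow> 'a word" where
  "plus_word u w = Word (letters u @ letters w)"

instance by standard (simp_all add: zero_word_def plus_word_def)

end

datatype ('v,'e) lpa_gen = Vertex 'v | Edge 'e | Ghost 'e

type_synonym ('v,'e,'k) lpa_poly = "('v,'e) lpa_gen word \<Rightarrow>\<^sub>0 'k"

definition gen :: "('v,'e) lpa_gen \<Rightarrow> ('v,'e,'k::field) lpa_poly" where
  "gen g = Poly_Mapping.single (Word [g]) 1"

abbreviation "vtx v \<equiv> gen (Vertex v)"
abbreviation "edg e \<equiv> gen (Edge e)"
abbreviation "gho e \<equiv> gen (Ghost e)"

definition scale :: "'k::field \<Rightarrow> ('v,'e,'k) lpa_poly \<Rightarrow> ('v,'e,'k) lpa_poly" where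
  "scale c x = Poly_Mapping.single 0 c * x"

definition lpa_gens :: "('v,'e) pre_digraph \<Rightarrow> ('v,'e) lpa_gen set" where
  "lpa_gens E = Vertex ` verts E \<union> Edge ` arcs E \<union> Ghost ` arcs E"

text \<open>The free nonunital algebra on the generators: the empty word is excluded.\<close>

definition lpa_free :: "('v,'e) pre_digraph \<Rightarrow> ('v,'e,'k::field) lpa_poly set" where
  "lpa_free E = {x. \<forall>w\<in>Poly_Mapping.keys x. letters w \<noteq> [] \<and> set (letters w) \<subseteq> lpa_gens E}"


section \<open>Leavitt path algebras\<close>

inductive_set lpa_relators :: "('v,'e) pre_digraph \<Rightarrow> ('v,'e,'k::field) lpa_poly set"
  for E :: "('v,'e) pre_digraph" where
  vertices: "\<lbrakk>v \<in> verts E; w \<in> verts E\<rbrakk>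
    \<Longrightarrow> vtx v * vtx w - (if v = w then vtx w else 0) \<in> lpa_relators E"
| source_edge: "e \<in> arcs E \<Longrightarrow> vtx (tail E e) * edg e - edg e \<in> lpa_relators E"
| edge_range: "e \<in> arcs E \<Longrightarrow> edg e * vtx (head E e) - edg e \<in> lpa_relators E"
| ghost_source: "e \<in> arcs E \<Longrightarrow> gho e * vtx (tail E e) - gho e \<in> lpa_relators E"
| range_ghost: "e \<in> arcs E \<Longrightarrow> vtx (head E e) * gho e - gho e \<in> lpa_relators E"
| cuntz_krieger1: "\<lbrakk>e \<in> arcs E; f \<in> arcs E\<rbrakk>
    \<Longrightarrow> gho e * edg f - (if e = f then vtx (head E e) else 0) \<in> lpa_relators E"
| cuntz_krieger2: "regular_vertex E v
    \<Longrightarrow> vtx v - (\<Sum>e\<in>out_arcs E v. edg e * gho e) \<in> lpa_relators E"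

inductive_set lpa_ideal :: "('v,'e) pre_digraph \<Rightarrow> ('v,'e,'k::field) lpa_poly set"
  for E :: "('v,'e) pre_digraph" where
  relator: "x \<in> lpa_relators E \<Longrightarrow> x \<in> lpa_ideal E"
| zero: "0 \<in> lpa_ideal E"
| add: "\<lbrakk>x \<in> lpa_ideal E; y \<in> lpa_ideal E\<rbrakk> \<Longrightarrow> x + y \<in> lpa_ideal E"
| scale: "x \<in> lpa_ideal E \<Longrightarrow> scale c x \<in> lpa_ideal E"
| left: "\<lbrakk>a \<in> lpa_free E; x \<in> lpa_ideal E\<rbrakk> \<Longrightarrow> a * x \<in> lpa_ideal E"
| right: "\<lbrakk>x \<in> lpa_ideal E; a \<in> lpa_free E\<rbrakk> \<Longrightarrow> x * a \<in> lpa_ideal E"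

definition lpa_rel :: "('v,'e) pre_digraph \<Rightarrow> ('v,'e,'k::field) lpa_poly rel" where
  "lpa_rel E = {(x, y). x \<in> lpa_free E \<and> y \<in> lpa_free E \<and> x - y \<in> lpa_ideal E}"

type_synonym ('v,'e,'k) lpa_elem = "('v,'e,'k) lpa_poly set"

definition lpa_class :: "('v,'e) pre_digraph \<Rightarrow> ('v,'e,'k::field) lpa_poly \<Rightarrow> ('v,'e,'k) lpa_elem" where
  "lpa_class E x = lpa_rel E `` {x}"

text \<open>The argument \<open>K\<close> only carries the scalar field as a type.\<close>

definition leavitt_path_algebra ::
    "'k::field itself \<Rightarrow> ('v,'e) pre_digraph \<Rightarrow> ('k, ('v,'e,'k) lpa_elem) algebra_struct" where
  "leavitt_path_algebra K E =
     \<lparr> elems = lpa_free E // lpa_rel E,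
       add = (\<lambda>X Y. \<Union>x\<in>X. \<Union>y\<in>Y. lpa_class E (x + y)),
       zer = lpa_class E 0,
       mul = (\<lambda>X Y. \<Union>x\<in>X. \<Union>y\<in>Y. lpa_class E (x * y)),
       scl = (\<lambda>c X. \<Union>x\<in>X. lpa_class E (scale c x)) \<rparr>"

definition lpa_vertex :: "'k::field itself \<Rightarrow> ('v,'e) pre_digraph \<Rightarrow> 'v \<Rightarrow> ('v,'e,'k) lpa_elem" where
  "lpa_vertex K E v = lpa_class E (vtx v)"

definition lpa_edge :: "'k::field itself \<Rightarrow> ('v,'e) pre_digraph \<Rightarrow> 'e \<Rightarrow> ('v,'e,'k) lpa_elem" where
  "lpa_edge K E e = lpa_class E (edg e)"

definition lpa_ghost :: "'k::field itself \<Rightarrow> ('v,'e) pre_digraph \<Rightarrow> 'e \<Rightarrow> ('v,'e,'k) lpa_elem" where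
  "lpa_ghost K E e = lpa_class E (gho e)"

fun gen_degree :: "('v,'e) lpa_gen \<Rightarrow> int" where
  "gen_degree (Vertex v) = 0"
| "gen_degree (Edge e) = 1"
| "gen_degree (Ghost e) = -1"

definition word_degree :: "('v,'e) lpa_gen word \<Rightarrow> int" where
  "word_degree w = sum_list (map gen_degree (letters w))"

definition lpa_component ::
    "'k::field itself \<Rightarrow> ('v,'e) pre_digraph \<Rightarrow> int \<Rightarrow> ('v,'e,'k) lpa_elem set" where
  "lpa_component K E n =
     lpa_class E ` {x \<in> lpa_free E. \<forall>w\<in>Poly_Mapping.keys x. word_degree w = n}"


section \<open>Well-definedness\<close>

lemma scale_simps:
  "scale c (x + y) = scale c x + scale c y"
  "scale c (x - y) = scale c x - scale c y"
  "scale (c + d) x = scale c x + scale d x"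
  "scale c (scale d x) = scale (c * d) x"
  "scale 1 x = x" "scale (-1) x = - x"
  "scale c x * y = scale c (x * y)"
  unfolding scale_def
  by (simp_all add: distrib_left distrib_right right_diff_distrib single_add single_uminus
      mult_single mult.assoc[symmetric])

lemma single_0_commute:
  fixes x :: "('v,'e,'k::field) lpa_poly"
  shows "Poly_Mapping.single 0 c * x = x * Poly_Mapping.single 0 c"
proof (induction x rule: update_induct)
  case const
  show ?case by simp
next
  case (update f a b)
  have "Poly_Mapping.update a b f = f + Poly_Mapping.single a b"
    using update by (intro poly_mapping_eqI)
      (auto simp: lookup_update lookup_add lookup_single when_def in_keys_iff)
  then show ?case
    using update by (simp add: algebra_simps mult_single)
qed

lemma mult_scale: "x * scale c y = scale c (x * y)"
  unfolding scale_def by (metis single_0_commute mult.assoc)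

lemma keys_scale: "Poly_Mapping.keys (scale c x) \<subseteq> Poly_Mapping.keys x"
  unfolding scale_def using keys_mult[of "Poly_Mapping.single 0 c" x]
  by (auto split: if_splits)

lemma lpa_free_0 [simp]: "0 \<in> lpa_free E"
  by (simp add: lpa_free_def)

lemma lpa_free_add [simp]: "\<lbrakk>x \<in> lpa_free E; y \<in> lpa_free E\<rbrakk> \<Longrightarrow> x + y \<in> lpa_free E"
  using keys_add[of x y] by (auto simp: lpa_free_def)

lemma lpa_free_scale [simp]: "x \<in> lpa_free E \<Longrightarrow> scale c x \<in> lpa_free E"
  using keys_scale[of c x] by (auto simp: lpa_free_def)

lemma lpa_free_uminus [simp]: "x \<in> lpa_free E \<Longrightarrow> - x \<in> lpa_free E"
  using lpa_free_scale[of x E "-1"] by (simp add: scale_simps)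

lemma lpa_free_diff [simp]: "\<lbrakk>x \<in> lpa_free E; y \<in> lpa_free E\<rbrakk> \<Longrightarrow> x - y \<in> lpa_free E"
  using lpa_free_add[of x E "- y"] by simp

lemma lpa_free_mult [simp]:
  assumes "x \<in> lpa_free E" "y \<in> lpa_free E"
  shows "x * y \<in> lpa_free E"
proof -
  have "letters w \<noteq> [] \<and> set (letters w) \<subseteq> lpa_gens E" if "w \<in> Poly_Mapping.keys (x * y)" for w
  proof -
    from that keys_mult[of x y] obtain u u' where
      "w = u + u'" "u \<in> Poly_Mapping.keys x" "u' \<in> Poly_Mapping.keys y" by blast
    with assms show ?thesis by (auto simp: lpa_free_def plus_word_def)
  qed
  then show ?thesis by (auto simp: lpa_free_def)
qed

lemma lpa_free_sum [simp]: "(\<And>i. i \<in> I \<Longrightarrow> f i \<in> lpa_free E) \<Longrightarrow> sum f I \<in> lpa_free E"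
  by (induction I rule: infinite_finite_induct) auto

lemma lpa_free_gen [simp]: "g \<in> lpa_gens E \<Longrightarrow> gen g \<in> lpa_free E"
  by (simp add: lpa_free_def gen_def)

lemma lpa_gens_simps [simp]:
  "Vertex v \<in> lpa_gens E \<longleftrightarrow> v \<in> verts E"
  "Edge e \<in> lpa_gens E \<longleftrightarrow> e \<in> arcs E"
  "Ghost e \<in> lpa_gens E \<longleftrightarrow> e \<in> arcs E"
  by (auto simp: lpa_gens_def)

lemma lpa_ideal_uminus: "x \<in> lpa_ideal E \<Longrightarrow> - x \<in> lpa_ideal E"
  using lpa_ideal.scale[of x E "-1"] by (simp add: scale_simps)

lemma lpa_ideal_sum: "(\<And>i. i \<in> I \<Longrightarrow> f i \<in> lpa_ideal E) \<Longrightarrow> sum f I \<in> lpa_ideal E"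
  by (induction I rule: infinite_finite_induct) (auto intro: lpa_ideal.zero lpa_ideal.add)

lemma equiv_lpa_rel: "equiv (lpa_free E) (lpa_rel E)"
proof (rule equivI)
  show "lpa_rel E \<subseteq> lpa_free E \<times> lpa_free E"
    by (auto simp: lpa_rel_def)
  show "refl_on (lpa_free E) (lpa_rel E)"
    by (auto simp: refl_on_def lpa_rel_def intro: lpa_ideal.zero)
  show "sym (lpa_rel E)"
    using lpa_ideal_uminus by (fastforce simp: sym_def lpa_rel_def)
  show "trans (lpa_rel E)"
    using lpa_ideal.add by (fastforce simp: trans_def lpa_rel_def)
qed

lemma lpa_class_eq_iff:
  "\<lbrakk>x \<in> lpa_free E; y \<in> lpa_free E\<rbrakk> \<Longrightarrow> lpa_class E x = lpa_class E y \<longleftrightarrow> x - y \<in> lpa_ideal E"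
  unfolding lpa_class_def using eq_equiv_class_iff[OF equiv_lpa_rel] by (auto simp: lpa_rel_def)

lemma lpa_elems: "elems (leavitt_path_algebra K E) = lpa_class E ` lpa_free E"
  by (auto simp: leavitt_path_algebra_def quotient_def lpa_class_def)

lemma lpa_zer: "zer (leavitt_path_algebra K E) = lpa_class E 0"
  by (simp add: leavitt_path_algebra_def)

lemma lpa_add:
  assumes "x \<in> lpa_free E" "y \<in> lpa_free E"
  shows "add (leavitt_path_algebra K E) (lpa_class E x) (lpa_class E y) = lpa_class E (x + y)"
proof -
  have "congruent2 (lpa_rel E) (lpa_rel E) (\<lambda>x y. lpa_class E (x + y))"
    by (auto simp: congruent2_def lpa_rel_def lpa_class_eq_iff add_diff_add intro: lpa_ideal.add)
  then show ?thesis
    using UN_equiv_class2[OF equiv_lpa_rel equiv_lpa_rel] assms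
    by (simp add: leavitt_path_algebra_def lpa_class_def)
qed

lemma lpa_mul:
  fixes x y :: "('v,'e,'k::field) lpa_poly"
  assumes "x \<in> lpa_free E" "y \<in> lpa_free E"
  shows "mul (leavitt_path_algebra K E) (lpa_class E x) (lpa_class E y) = lpa_class E (x * y)"
proof -
  have *: "x * y - x' * y' \<in> lpa_ideal E"
    if "y \<in> lpa_free E" "x' \<in> lpa_free E" "x - x' \<in> lpa_ideal E" "y - y' \<in> lpa_ideal E"
    for x x' y y' :: "('v,'e,'k) lpa_poly"
  proof -
    have "x * y - x' * y' = (x - x') * y + x' * (y - y')" by (simp add: algebra_simps)
    then show ?thesis using that by (metis lpa_ideal.add lpa_ideal.left lpa_ideal.right)
  qed
  have "congruent2 (lpa_rel E) (lpa_rel E) 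
      (\<lambda>x y :: ('v,'e,'k) lpa_poly. lpa_class E (x * y))"
    by (auto simp: congruent2_def lpa_rel_def lpa_class_eq_iff intro!: *)
  then show ?thesis
    using UN_equiv_class2[OF equiv_lpa_rel equiv_lpa_rel] assms
    by (simp add: leavitt_path_algebra_def lpa_class_def)
qed

lemma lpa_scl:
  assumes "x \<in> lpa_free E"
  shows "scl (leavitt_path_algebra K E) c (lpa_class E x) = lpa_class E (scale c x)"
proof -
  have "congruent (lpa_rel E) (\<lambda>x. lpa_class E (scale c x))"
    using lpa_ideal.scale
    by (auto simp: congruent_def lpa_rel_def lpa_class_eq_iff scale_simps(2)[symmetric])
  then show ?thesis
    using UN_equiv_class[OF equiv_lpa_rel] assms
    by (simp add: leavitt_path_algebra_def lpa_class_def)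
qed

lemma nonunital_algebra_lpa: "nonunital_algebra (leavitt_path_algebra K E)"
proof
  fix x assume "x \<in> elems (leavitt_path_algebra K E)"
  then obtain a where a: "x = lpa_class E a" "a \<in> lpa_free E" by (auto simp: lpa_elems)
  then show "\<exists>y\<in>elems (leavitt_path_algebra K E). add (leavitt_path_algebra K E) x y =
      zer (leavitt_path_algebra K E)"
    by (intro bexI[of _ "lpa_class E (- a)"]) (auto simp: lpa_elems lpa_add lpa_zer)
qed (auto simp: lpa_elems lpa_zer lpa_add lpa_mul lpa_scl scale_simps mult_scale algebra_simps)

lemma lpa_identity:
  fixes K :: "'k::field itself" and E :: "('v,'e) pre_digraph"
  assumes E: "wf_digraph E" and fin: "finite (verts E)"
  shows "is_identity (leavitt_path_algebra K E) (lpa_class E (\<Sum>v\<in>verts E. vtx v))"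
proof -
  define S :: "('v,'e,'k) lpa_poly" where "S = (\<Sum>v\<in>verts E. vtx v)"
  have S: "S \<in> lpa_free E" by (simp add: S_def)
  have hd: "tail E e \<in> verts E" "head E e \<in> verts E" if "e \<in> arcs E" for e
    using E that by (simp_all add: wf_digraph_def)
  have vS: "S * vtx w - vtx w \<in> lpa_ideal E" "vtx w * S - vtx w \<in> lpa_ideal E"
    if w: "w \<in> verts E" for w
  proof -
    have "S * vtx w - vtx w = (\<Sum>v\<in>verts E. vtx v * vtx w - (if v = w then vtx w else 0))"
      using fin w by (simp add: S_def sum_distrib_right sum_subtractf)
    then show "S * vtx w - vtx w \<in> lpa_ideal E"
      using w by (auto intro!: lpa_ideal_sum lpa_ideal.relator[OF lpa_relators.vertices])
    have "vtx w * S - vtx w = (\<Sum>v\<in>verts E. vtx w * vtx v - (if w = v then vtx v else 0))"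
      using fin w by (simp add: S_def sum_distrib_left sum_subtractf)
    then show "vtx w * S - vtx w \<in> lpa_ideal E"
      using w by (auto intro!: lpa_ideal_sum lpa_ideal.relator[OF lpa_relators.vertices])
  qed
  have left: "S * a - a \<in> lpa_ideal E"
    if "w \<in> verts E" "a \<in> lpa_free E" "vtx w * a - a \<in> lpa_ideal E" for w a
  proof -
    have "S * a - a = (S * vtx w - vtx w) * a + (- (S * (vtx w * a - a))) + (vtx w * a - a)"
      by (simp add: algebra_simps)
    then show ?thesis
      using that vS S by (metis lpa_ideal.add lpa_ideal.left lpa_ideal.right lpa_ideal_uminus)
  qed
  have right: "a * S - a \<in> lpa_ideal E"
    if "w \<in> verts E" "a \<in> lpa_free E" "a * vtx w - a \<in> lpa_ideal E" for w a
  proof -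
    have "a * S - a = a * (vtx w * S - vtx w) + (- ((a * vtx w - a) * S)) + (a * vtx w - a)"
      by (simp add: algebra_simps)
    then show ?thesis
      using that vS S by (metis lpa_ideal.add lpa_ideal.left lpa_ideal.right lpa_ideal_uminus)
  qed
  have gen: "S * gen g - gen g \<in> lpa_ideal E \<and> gen g * S - gen g \<in> lpa_ideal E"
    if "g \<in> lpa_gens E" for g
  proof (cases g)
    case (Vertex v)
    then show ?thesis using that vS by simp
  next
    case (Edge e)
    then show ?thesis using that hd
      by (auto intro!: left[of "tail E e"] right[of "head E e"]
          lpa_ideal.relator[OF lpa_relators.source_edge] lpa_ideal.relator[OF lpa_relators.edge_range])
  next
    case (Ghost e)
    then show ?thesis using that hd
      by (auto intro!: left[of "head E e"] right[of "tail E e"]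
          lpa_ideal.relator[OF lpa_relators.ghost_source] lpa_ideal.relator[OF lpa_relators.range_ghost])
  qed
  have mon: "S * Poly_Mapping.single (Word l) c - Poly_Mapping.single (Word l) c \<in> lpa_ideal E \<and>
      Poly_Mapping.single (Word l) c * S - Poly_Mapping.single (Word l) c \<in> lpa_ideal E"
    if l: "l \<noteq> []" "set l \<subseteq> lpa_gens E" for l c
  proof -
    define m :: "('v,'e,'k) lpa_poly" where "m = Poly_Mapping.single (Word l) c"
    have "\<exists>b. m = scale c (gen (hd l)) * b \<and> (b = 1 \<or> b \<in> lpa_free E)"
      using l by (intro exI[of _ "Poly_Mapping.single (Word (tl l)) 1"], cases l)
        (auto simp: m_def scale_def gen_def mult_single plus_word_def zero_word_def lpa_free_def
          single_one[symmetric] simp del: single_one)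
    then obtain b where b: "m = scale c (gen (hd l)) * b" "b = 1 \<or> b \<in> lpa_free E" by blast
    have 1: "S * m - m = scale c ((S * gen (hd l) - gen (hd l)) * b)"
      by (simp add: b(1) scale_simps mult_scale algebra_simps)
    have "\<exists>b. m = b * scale c (gen (last l)) \<and> (b = 1 \<or> b \<in> lpa_free E)"
      using l by (intro exI[of _ "Poly_Mapping.single (Word (butlast l)) 1"], cases l rule: rev_cases)
        (auto simp: m_def scale_def gen_def mult_single plus_word_def zero_word_def lpa_free_def
          single_one[symmetric] simp del: single_one)
    then obtain b' where b': "m = b' * scale c (gen (last l))" "b' = 1 \<or> b' \<in> lpa_free E" by blast
    have 2: "m * S - m = scale c (b' * (gen (last l) * S - gen (last l)))"
      by (simp add: b'(1) scale_simps mult_scale algebra_simps)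
    have "hd l \<in> lpa_gens E" "last l \<in> lpa_gens E" using l by auto
    then have "(S * gen (hd l) - gen (hd l)) * b \<in> lpa_ideal E"
      and "b' * (gen (last l) * S - gen (last l)) \<in> lpa_ideal E"
      using gen b(2) b'(2) lpa_ideal.right lpa_ideal.left
      by (metis mult_1_right, metis mult_1_left)
    then show ?thesis
      unfolding m_def[symmetric] 1 2 by (simp add: lpa_ideal.scale)
  qed
  have all: "S * x - x \<in> lpa_ideal E \<and> x * S - x \<in> lpa_ideal E" if "x \<in> lpa_free E" for x
    using that
  proof (induction x rule: update_induct)
    case const
    show ?case by (simp add: lpa_ideal.zero)
  next
    case (update f a b)
    have eq: "Poly_Mapping.update a b f = f + Poly_Mapping.single a b"
      using update by (intro poly_mapping_eqI)
        (auto simp: lookup_update lookup_add lookup_single when_def in_keys_iff)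
    have "f \<in> lpa_free E" "letters a \<noteq> []" "set (letters a) \<subseteq> lpa_gens E"
      using update.prems update.hyps by (auto simp: lpa_free_def keys_update)
    with update.IH mon[of "letters a" b] show ?case
      unfolding eq distrib_left distrib_right add_diff_add by (auto intro!: lpa_ideal.add)
  qed
  then show ?thesis
    using S by (auto simp: is_identity_def lpa_elems lpa_mul lpa_class_eq_iff S_def[symmetric])
qed

end

theory Submission
  imports Defs
begin

text \<open>A graph automorphism permutes the generators of the free nonunital algebra and therefore
  acts on it by relabelling the letters of words. The relabelling is multiplicative, so it maps
  the ideal of relations into itself as soon as it maps each defining relator to a defining relator.
  For the relation \<open>v = \<Sum>e e\<^sup>*\<close> at a regular vertex this holds because \<open>\<sigma>\<^sub>1\<close> restricts to a
  bijection from the edges leaving \<open>v\<close> to the edges leaving \<open>\<sigma>\<^sub>0 v\<close>; for \<open>v w = \<delta> w\<close> and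
  \<open>e\<^sup>* f = \<delta> r(e)\<close> it holds because \<open>\<sigma>\<^sub>0\<close> and \<open>\<sigma>\<^sub>1\<close> are injective. Relabelling hence descends to an
  endomorphism of the quotient (\<open>algebra_hom_lpa_map\<close>), and it preserves word degrees.

  The inverse pair of maps is a graph automorphism too, and its endomorphism is a two-sided inverse
  (\<open>lpa_map_lpa_map\<close>). Bijectivity on the algebra and on each homogeneous component both follow from
  this. Finally, \<open>\<sigma>\<^sub>0\<close> permutes the summands of the identity \<open>\<Sum>v\<close>.\<close>

section \<open>Pushing polynomial mappings forward along a map of exponents\<close>

text \<open>The linear extension of a map of monomials. It is defined for non-injective maps as well:
  a graph automorphism is only injective on the graph, while words range over a whole type.\<close>

definition push_keys :: "('a \<Rightarrow> 'b) \<Rightarrow> ('a \<Rightarrow>\<^sub>0 'c::comm_monoid_add) \<Rightarrow> ('b \<Rightarrow>\<^sub>0 'c)" where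
  "push_keys f x = (\<Sum>w\<in>Poly_Mapping.keys x. Poly_Mapping.single (f w) (Poly_Mapping.lookup x w))"

lemma push_keys_superset:
  assumes "finite S" "Poly_Mapping.keys x \<subseteq> S"
  shows "push_keys f x = (\<Sum>w\<in>S. Poly_Mapping.single (f w) (Poly_Mapping.lookup x w))"
  unfolding push_keys_def using assms
  by (intro sum.mono_neutral_left) (auto simp: in_keys_iff)

lemma push_keys_0 [simp]: "push_keys f 0 = 0"
  by (simp add: push_keys_def)

lemma push_keys_single [simp]:
  "push_keys f (Poly_Mapping.single w c) = Poly_Mapping.single (f w) c"
  by (simp add: push_keys_superset[of "{w}"])

lemma push_keys_add [simp]: "push_keys f (x + y) = push_keys f x + push_keys f y"
proof -
  let ?S = "Poly_Mapping.keys x \<union> Poly_Mapping.keys y"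
  have "Poly_Mapping.keys (x + y) \<subseteq> ?S" by (rule keys_add)
  then show ?thesis
    by (simp add: push_keys_superset[of ?S] lookup_add single_add sum.distrib)
qed

lemma push_keys_diff [simp]:
  fixes x y :: "'a \<Rightarrow>\<^sub>0 'c::ab_group_add"
  shows "push_keys f (x - y) = push_keys f x - push_keys f y"
  by (metis push_keys_add add_diff_cancel diff_add_cancel)

lemma push_keys_sum [simp]: "push_keys f (sum g I) = (\<Sum>i\<in>I. push_keys f (g i))"
  by (induction I rule: infinite_finite_induct) auto

lemma poly_mapping_single_induct [case_names zero single_add]:
  fixes x :: "'a \<Rightarrow>\<^sub>0 'c::comm_monoid_add"
  assumes "P 0" "\<And>w c x. P x \<Longrightarrow> P (x + Poly_Mapping.single w c)"
  shows "P x"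
proof (induction x rule: update_induct)
  case const
  show ?case by (rule assms)
next
  case (update x w c)
  have "Poly_Mapping.update w c x = x + Poly_Mapping.single w c"
    using update by (intro poly_mapping_eqI)
      (auto simp: lookup_update lookup_add lookup_single when_def in_keys_iff)
  then show ?case using assms(2) update.IH by simp
qed

lemma push_keys_mult:
  fixes x y :: "'a::monoid_add \<Rightarrow>\<^sub>0 'c::semiring_0"
  assumes f: "\<And>u w. f (u + w) = f u + f w"
  shows "push_keys f (x * y) = push_keys f x * push_keys f y"
proof (induction x rule: poly_mapping_single_induct)
  case (single_add u c x)
  have "push_keys f (Poly_Mapping.single u c * y) = Poly_Mapping.single (f u) c * push_keys f y"
    by (induction y rule: poly_mapping_single_induct) (simp_all add: distrib_left mult_single f)
  with single_add show ?case by (simp add: distrib_right)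
qed simp

lemma push_keys_push_keys: "push_keys f (push_keys g x) = push_keys (f \<circ> g) x"
  by (induction x rule: poly_mapping_single_induct) simp_all

lemma push_keys_ident:
  assumes "\<And>w. w \<in> Poly_Mapping.keys x \<Longrightarrow> f w = w"
  shows "push_keys f x = x"
proof -
  have "push_keys f x = push_keys (\<lambda>w. w) x"
    unfolding push_keys_def using assms by (intro sum.cong) auto
  also have "\<dots> = x"
    by (induction x rule: poly_mapping_single_induct) simp_all
  finally show ?thesis .
qed

lemma keys_push_keys: "Poly_Mapping.keys (push_keys f x) \<subseteq> f ` Poly_Mapping.keys x"
proof
  fix u assume "u \<in> Poly_Mapping.keys (push_keys f x)"
  then have "(\<Sum>w\<in>Poly_Mapping.keys x.
      Poly_Mapping.lookup (Poly_Mapping.single (f w) (Poly_Mapping.lookup x w)) u) \<noteq> 0"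
    by (simp add: push_keys_def in_keys_iff lookup_sum)
  then obtain w where "w \<in> Poly_Mapping.keys x"
      "Poly_Mapping.lookup (Poly_Mapping.single (f w) (Poly_Mapping.lookup x w)) u \<noteq> 0"
    by (rule sum.not_neutral_contains_not_neutral)
  then show "u \<in> f ` Poly_Mapping.keys x" by (auto simp: lookup_single when_def split: if_splits)
qed


section \<open>Relabelling the generators\<close>

abbreviation relabel_word ::
    "('v \<Rightarrow> 'v) \<Rightarrow> ('e \<Rightarrow> 'e) \<Rightarrow> ('v,'e) lpa_gen word \<Rightarrow> ('v,'e) lpa_gen word" where
  "relabel_word \<sigma>0 \<sigma>1 \<equiv> map_word (map_lpa_gen \<sigma>0 \<sigma>1)"

definition relabel ::
    "('v \<Rightarrow> 'v) \<Rightarrow> ('e \<Rightarrow> 'e) \<Rightarrow> ('v,'e,'k::field) lpa_poly \<Rightarrow> ('v,'e,'k) lpa_poly" where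
  "relabel \<sigma>0 \<sigma>1 = push_keys (relabel_word \<sigma>0 \<sigma>1)"

lemma letters_map_word [simp]: "letters (map_word f w) = map f (letters w)"
  by (cases w) simp

lemma map_word_plus: "map_word f (u + w) = map_word f u + map_word f w"
  by (simp add: plus_word_def)

lemma relabel_linear [simp]:
  "relabel \<sigma>0 \<sigma>1 0 = 0"
  "relabel \<sigma>0 \<sigma>1 (x + y) = relabel \<sigma>0 \<sigma>1 x + relabel \<sigma>0 \<sigma>1 y"
  "relabel \<sigma>0 \<sigma>1 (x - y) = relabel \<sigma>0 \<sigma>1 x - relabel \<sigma>0 \<sigma>1 y"
  "relabel \<sigma>0 \<sigma>1 (sum f I) = (\<Sum>i\<in>I. relabel \<sigma>0 \<sigma>1 (f i))"
  by (simp_all add: relabel_def)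

lemma relabel_mult [simp]: "relabel \<sigma>0 \<sigma>1 (x * y) = relabel \<sigma>0 \<sigma>1 x * relabel \<sigma>0 \<sigma>1 y"
  unfolding relabel_def by (rule push_keys_mult) (rule map_word_plus)

lemma relabel_scale [simp]: "relabel \<sigma>0 \<sigma>1 (scale c x) = scale c (relabel \<sigma>0 \<sigma>1 x)"
proof -
  have "relabel \<sigma>0 \<sigma>1 (Poly_Mapping.single 0 c) = Poly_Mapping.single 0 c"
    by (simp add: relabel_def zero_word_def)
  then show ?thesis by (simp add: scale_def)
qed

lemma relabel_gen [simp]: "relabel \<sigma>0 \<sigma>1 (gen g) = gen (map_lpa_gen \<sigma>0 \<sigma>1 g)"
  by (simp add: relabel_def gen_def)

lemma keys_relabel:
  "Poly_Mapping.keys (relabel \<sigma>0 \<sigma>1 x) \<subseteq> relabel_word \<sigma>0 \<sigma>1 ` Poly_Mapping.keys x"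
  unfolding relabel_def by (rule keys_push_keys)

lemma gen_degree_map [simp]: "gen_degree (map_lpa_gen \<sigma>0 \<sigma>1 g) = gen_degree g"
  by (cases g) simp_all

lemma word_degree_relabel [simp]: "word_degree (relabel_word \<sigma>0 \<sigma>1 w) = word_degree w"
  by (simp add: word_degree_def comp_def)

lemma relabel_lpa_free:
  assumes "\<sigma>0 ` verts E \<subseteq> verts E" "\<sigma>1 ` arcs E \<subseteq> arcs E" "x \<in> lpa_free E"
  shows "relabel \<sigma>0 \<sigma>1 x \<in> lpa_free E"
proof -
  have "map_lpa_gen \<sigma>0 \<sigma>1 ` lpa_gens E \<subseteq> lpa_gens E"
    using assms(1,2) by (auto simp: lpa_gens_def)
  then show ?thesis
    using keys_relabel[of \<sigma>0 \<sigma>1 x] assms(3) by (fastforce simp: lpa_free_def)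
qed

lemma relabel_relabel_ident:
  assumes "\<And>v. v \<in> verts E \<Longrightarrow> \<tau>0 (\<sigma>0 v) = v" "\<And>e. e \<in> arcs E \<Longrightarrow> \<tau>1 (\<sigma>1 e) = e"
    and "x \<in> lpa_free E"
  shows "relabel \<tau>0 \<tau>1 (relabel \<sigma>0 \<sigma>1 x) = x"
  unfolding relabel_def push_keys_push_keys
proof (rule push_keys_ident)
  fix w assume "w \<in> Poly_Mapping.keys x"
  then have "set (letters w) \<subseteq> lpa_gens E" using assms(3) by (simp add: lpa_free_def)
  then have "map (map_lpa_gen \<tau>0 \<tau>1 \<circ> map_lpa_gen \<sigma>0 \<sigma>1) (letters w) = letters w"
    using assms(1,2) by (intro map_idI) (auto simp: lpa_gens_def)
  then show "(relabel_word \<tau>0 \<tau>1 \<circ> relabel_word \<sigma>0 \<sigma>1) w = w"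
    by (cases w) simp
qed


section \<open>Graph automorphisms and the defining relations\<close>

lemma graph_automorphism_maps:
  assumes "graph_automorphism E \<sigma>0 \<sigma>1"
  shows "\<sigma>0 ` verts E = verts E" "\<sigma>1 ` arcs E = arcs E"
    and "inj_on \<sigma>0 (verts E)" "inj_on \<sigma>1 (arcs E)"
  using assms by (auto simp: graph_automorphism_def bij_betw_def)

lemma relabel_free:
  assumes "graph_automorphism E \<sigma>0 \<sigma>1" "x \<in> lpa_free E"
  shows "relabel \<sigma>0 \<sigma>1 x \<in> lpa_free E"
  using assms(2) by (intro relabel_lpa_free) (simp_all add: graph_automorphism_maps[OF assms(1)])

lemma graph_automorphism_inv:
  assumes E: "wf_digraph E" and \<sigma>: "graph_automorphism E \<sigma>0 \<sigma>1"
  shows "graph_automorphism E (inv_into (verts E) \<sigma>0) (inv_into (arcs E) \<sigma>1)"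
proof -
  note \<sigma>' = graph_automorphism_maps[OF \<sigma>]
  have "tail E (inv_into (arcs E) \<sigma>1 e) = inv_into (verts E) \<sigma>0 (tail E e) \<and>
      head E (inv_into (arcs E) \<sigma>1 e) = inv_into (verts E) \<sigma>0 (head E e)" if "e \<in> arcs E" for e
  proof -
    have "e \<in> \<sigma>1 ` arcs E" using that by (simp add: \<sigma>'(2))
    then obtain d where d: "d \<in> arcs E" "e = \<sigma>1 d" by (auto elim: imageE)
    have "tail E d \<in> verts E" "head E d \<in> verts E"
      using E d(1) by (simp_all add: wf_digraph_def)
    moreover have "tail E e = \<sigma>0 (tail E d)" "head E e = \<sigma>0 (head E d)"
      using \<sigma> d by (simp_all add: graph_automorphism_def)
    moreover have "inv_into (arcs E) \<sigma>1 e = d"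
      using d \<sigma>'(4) by simp
    ultimately show ?thesis using \<sigma>'(3) by simp
  qed
  then show ?thesis
    using \<sigma> unfolding graph_automorphism_def by (blast intro: bij_betw_inv_into)
qed

lemma out_arcs_automorphism:
  assumes E: "wf_digraph E" and \<sigma>: "graph_automorphism E \<sigma>0 \<sigma>1" and v: "v \<in> verts E"
  shows "out_arcs E (\<sigma>0 v) = \<sigma>1 ` out_arcs E v"
proof
  note \<sigma>' = graph_automorphism_maps[OF \<sigma>]
  show "out_arcs E (\<sigma>0 v) \<subseteq> \<sigma>1 ` out_arcs E v"
  proof
    fix e assume e: "e \<in> out_arcs E (\<sigma>0 v)"
    then obtain d where d: "d \<in> arcs E" "e = \<sigma>1 d" using \<sigma>'(2) by (auto simp: out_arcs_def)
    then have "\<sigma>0 (tail E d) = \<sigma>0 v" using e \<sigma> by (simp add: out_arcs_def graph_automorphism_def)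
    moreover have "tail E d \<in> verts E" using E d by (simp add: wf_digraph_def)
    ultimately have "tail E d = v" using \<sigma>'(3) v by (auto dest: inj_onD)
    with d show "e \<in> \<sigma>1 ` out_arcs E v" by (auto simp: out_arcs_def)
  qed
  show "\<sigma>1 ` out_arcs E v \<subseteq> out_arcs E (\<sigma>0 v)"
    using \<sigma> \<sigma>'(2) by (auto simp: out_arcs_def graph_automorphism_def)
qed

text \<open>Injectivity keeps the case distinctions \<open>v = w\<close> and \<open>e = f\<close> inside the relators unchanged, and the
  bijection of outgoing edges both transports regularity of a vertex and reindexes the sum in the
  second Cuntz-Krieger relator.\<close>

lemma relabel_relator:
  assumes E: "wf_digraph E" and \<sigma>: "graph_automorphism E \<sigma>0 \<sigma>1" and x: "x \<in> lpa_relators E"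
  shows "relabel \<sigma>0 \<sigma>1 x \<in> lpa_relators E"
proof -
  note \<sigma>' = graph_automorphism_maps[OF \<sigma>]
  have V: "\<sigma>0 v \<in> verts E" if "v \<in> verts E" for v using \<sigma>'(1) that by blast
  have A: "\<sigma>1 e \<in> arcs E" if "e \<in> arcs E" for e using \<sigma>'(2) that by blast
  have th: "\<sigma>0 (tail E e) = tail E (\<sigma>1 e)" "\<sigma>0 (head E e) = head E (\<sigma>1 e)" if "e \<in> arcs E" for e
    using \<sigma> that by (simp_all add: graph_automorphism_def)
  from x show ?thesis
  proof cases
    case (vertices v w)
    then show ?thesis
      using lpa_relators.vertices[OF V V, of v w] inj_on_eq_iff[OF \<sigma>'(3), of v w]
      by (cases "v = w") simp_all
  next
    case (source_edge e)
    then show ?thesis using lpa_relators.source_edge[OF A, of e] by (simp add: th)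
  next
    case (edge_range e)
    then show ?thesis using lpa_relators.edge_range[OF A, of e] by (simp add: th)
  next
    case (ghost_source e)
    then show ?thesis using lpa_relators.ghost_source[OF A, of e] by (simp add: th)
  next
    case (range_ghost e)
    then show ?thesis using lpa_relators.range_ghost[OF A, of e] by (simp add: th)
  next
    case (cuntz_krieger1 e f)
    then show ?thesis
      using lpa_relators.cuntz_krieger1[OF A A, of e f] inj_on_eq_iff[OF \<sigma>'(4), of e f]
      by (cases "e = f") (simp_all add: th)
  next
    case (cuntz_krieger2 v)
    then have v: "v \<in> verts E" by (simp add: regular_vertex_def)
    note out = out_arcs_automorphism[OF E \<sigma> v]
    have "regular_vertex E (\<sigma>0 v)"
      using cuntz_krieger2 V by (simp add: regular_vertex_def out)
    moreover have "inj_on \<sigma>1 (out_arcs E v)"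
      using \<sigma>'(4) by (rule inj_on_subset) (auto simp: out_arcs_def)
    ultimately show ?thesis
      using lpa_relators.cuntz_krieger2[of E "\<sigma>0 v"] cuntz_krieger2
      by (simp add: out sum.reindex)
  qed
qed

lemma relabel_ideal:
  assumes "wf_digraph E" "graph_automorphism E \<sigma>0 \<sigma>1" "x \<in> lpa_ideal E"
  shows "relabel \<sigma>0 \<sigma>1 x \<in> lpa_ideal E"
  using assms(3)
proof induction
  case (relator x)
  then show ?case using relabel_relator assms(1,2) by (blast intro: lpa_ideal.relator)
qed (auto intro: lpa_ideal.intros relabel_free[OF assms(2)])


section \<open>The induced map on the Leavitt path algebra\<close>

definition lpa_map ::
    "('v,'e) pre_digraph \<Rightarrow> ('v \<Rightarrow> 'v) \<Rightarrow> ('e \<Rightarrow> 'e) \<Rightarrow> ('v,'e,'k::field) lpa_elem \<Rightarrow> ('v,'e,'k) lpa_elem"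
  where "lpa_map E \<sigma>0 \<sigma>1 X = (\<Union>x\<in>X. lpa_class E (relabel \<sigma>0 \<sigma>1 x))"

context
  fixes E :: "('v,'e) pre_digraph" and \<sigma>0 :: "'v \<Rightarrow> 'v" and \<sigma>1 :: "'e \<Rightarrow> 'e"
  assumes E: "wf_digraph E" and \<sigma>: "graph_automorphism E \<sigma>0 \<sigma>1"
begin

lemma lpa_map_class:
  assumes x: "x \<in> lpa_free E"
  shows "lpa_map E \<sigma>0 \<sigma>1 (lpa_class E x) = lpa_class E (relabel \<sigma>0 \<sigma>1 x)"
proof -
  have "congruent (lpa_rel E) (\<lambda>x. lpa_class E (relabel \<sigma>0 \<sigma>1 x))"
  proof (rule congruentI)
    fix a b assume "(a, b) \<in> lpa_rel E"
    then have ab: "a \<in> lpa_free E" "b \<in> lpa_free E" "a - b \<in> lpa_ideal E"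
      by (simp_all add: lpa_rel_def)
    then have "relabel \<sigma>0 \<sigma>1 a - relabel \<sigma>0 \<sigma>1 b \<in> lpa_ideal E"
      using relabel_ideal[OF E \<sigma> ab(3)] by simp
    with ab show "lpa_class E (relabel \<sigma>0 \<sigma>1 a) = lpa_class E (relabel \<sigma>0 \<sigma>1 b)"
      by (simp add: lpa_class_eq_iff relabel_free[OF \<sigma>])
  qed
  then show ?thesis
    using UN_equiv_class[OF equiv_lpa_rel] x by (simp add: lpa_map_def lpa_class_def)
qed

lemma algebra_hom_lpa_map:
  "algebra_hom (leavitt_path_algebra K E) (leavitt_path_algebra K E) (lpa_map E \<sigma>0 \<sigma>1)"
  by (auto simp: algebra_hom_def lpa_elems lpa_add lpa_mul lpa_scl lpa_map_class relabel_free[OF \<sigma>])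

lemma lpa_map_component: "lpa_map E \<sigma>0 \<sigma>1 ` lpa_component K E n \<subseteq> lpa_component K E n"
proof -
  have "word_degree w = n" if "\<forall>w\<in>Poly_Mapping.keys x. word_degree w = n"
    and "w \<in> Poly_Mapping.keys (relabel \<sigma>0 \<sigma>1 x)" for x :: "('v,'e,'k::field) lpa_poly" and w
    using that keys_relabel[of \<sigma>0 \<sigma>1 x] by auto
  then show ?thesis
    by (auto simp: lpa_component_def lpa_map_class intro!: imageI relabel_free[OF \<sigma>])
qed

end

text \<open>The inverse relations are assumed on vertices and edges only, since maps such as
  \<^const>\<open>inv_into\<close> are unspecified elsewhere.\<close>

lemma lpa_map_lpa_map:
  assumes "wf_digraph E" "graph_automorphism E \<sigma>0 \<sigma>1" "graph_automorphism E \<tau>0 \<tau>1"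
    and "\<And>v. v \<in> verts E \<Longrightarrow> \<tau>0 (\<sigma>0 v) = v" "\<And>e. e \<in> arcs E \<Longrightarrow> \<tau>1 (\<sigma>1 e) = e"
    and "X \<in> elems (leavitt_path_algebra K E)"
  shows "lpa_map E \<tau>0 \<tau>1 (lpa_map E \<sigma>0 \<sigma>1 X) = X"
proof -
  obtain x where x: "x \<in> lpa_free E" "X = lpa_class E x" using assms(6) by (auto simp: lpa_elems)
  moreover have "relabel \<tau>0 \<tau>1 (relabel \<sigma>0 \<sigma>1 x) = x"
    using assms(4,5) x(1) by (rule relabel_relabel_ident)
  ultimately show ?thesis
    using assms(1-3) by (simp add: lpa_map_class relabel_free)
qed

lemma graded_algebra_automorphism_lpa_map:
  fixes K :: "'k::field itself"
  assumes E: "wf_digraph E" and \<sigma>: "graph_automorphism E \<sigma>0 \<sigma>1"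
  shows "graded_algebra_automorphism (leavitt_path_algebra K E) (lpa_component K E)
    (lpa_map E \<sigma>0 \<sigma>1)"
proof -
  define \<tau>0 \<tau>1 where "\<tau>0 = inv_into (verts E) \<sigma>0" and "\<tau>1 = inv_into (arcs E) \<sigma>1"
  let ?A = "leavitt_path_algebra K E"
  let ?\<phi> = "lpa_map E \<sigma>0 \<sigma>1" and ?\<psi> = "lpa_map E \<tau>0 \<tau>1"
  note \<sigma>' = graph_automorphism_maps[OF \<sigma>]
  have \<tau>: "graph_automorphism E \<tau>0 \<tau>1"
    unfolding \<tau>0_def \<tau>1_def using E \<sigma> by (rule graph_automorphism_inv)
  have \<psi>\<phi>: "?\<psi> (?\<phi> X) = X" if "X \<in> elems ?A" for X
    using E \<sigma> \<tau> _ _ that by (rule lpa_map_lpa_map) (simp_all add: \<tau>0_def \<tau>1_def \<sigma>'(3,4))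
  have \<phi>\<psi>: "?\<phi> (?\<psi> X) = X" if "X \<in> elems ?A" for X
    using E \<tau> \<sigma> _ _ that
    by (rule lpa_map_lpa_map) (simp_all add: \<tau>0_def \<tau>1_def f_inv_into_f \<sigma>'(1,2))
  have "bij_betw ?\<phi> (elems ?A) (elems ?A)"
    using algebra_hom_lpa_map[OF E \<sigma>, of K] algebra_hom_lpa_map[OF E \<tau>, of K]
    by (intro bij_betw_byWitness[where f' = ?\<psi>]) (auto simp: algebra_hom_def \<psi>\<phi> \<phi>\<psi>)
  moreover have "?\<phi> ` lpa_component K E n = lpa_component K E n" for n
  proof
    show "?\<phi> ` lpa_component K E n \<subseteq> lpa_component K E n"
      by (rule lpa_map_component[OF E \<sigma>])
    show "lpa_component K E n \<subseteq> ?\<phi> ` lpa_component K E n"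
    proof
      fix X assume X: "X \<in> lpa_component K E n"
      then have "X = ?\<phi> (?\<psi> X)" by (auto simp: lpa_component_def lpa_elems \<phi>\<psi>)
      then show "X \<in> ?\<phi> ` lpa_component K E n"
        using X lpa_map_component[OF E \<tau>] by blast
    qed
  qed
  ultimately show ?thesis
    using algebra_hom_lpa_map[OF E \<sigma>]
    by (simp add: graded_algebra_automorphism_def algebra_automorphism_def)
qed

lemma unital_lpa_map:
  fixes K :: "'k::field itself" and E :: "('v,'e) pre_digraph"
  assumes E: "wf_digraph E" and \<sigma>: "graph_automorphism E \<sigma>0 \<sigma>1" and fin: "finite (verts E)"
  shows "unital_map (leavitt_path_algebra K E) (leavitt_path_algebra K E) (lpa_map E \<sigma>0 \<sigma>1)"
proof -
  let ?S = "(\<Sum>v\<in>verts E. vtx v) :: ('v,'e,'k) lpa_poly"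
  note \<sigma>' = graph_automorphism_maps[OF \<sigma>]
  have "relabel \<sigma>0 \<sigma>1 ?S = (\<Sum>v\<in>\<sigma>0 ` verts E. vtx v)"
    by (simp add: sum.reindex[OF \<sigma>'(3)])
  then have "lpa_map E \<sigma>0 \<sigma>1 (lpa_class E ?S) = lpa_class E ?S"
    by (simp add: lpa_map_class[OF E \<sigma>] \<sigma>'(1))
  then show ?thesis
    using lpa_identity[OF E fin, of K] unfolding unital_map_def by metis
qed

theorem lemma2p4:
  fixes K :: "'k::field itself" and E :: "('v,'e) pre_digraph"
    and \<sigma>0 :: "'v \<Rightarrow> 'v" and \<sigma>1 :: "'e \<Rightarrow> 'e"
  assumes "wf_digraph E" and "graph_automorphism E \<sigma>0 \<sigma>1"
  shows "\<exists>\<phi>. graded_algebra_automorphism (leavitt_path_algebra K E) (lpa_component K E) \<phi> \<and>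
    (\<forall>v\<in>verts E. \<phi> (lpa_vertex K E v) = lpa_vertex K E (\<sigma>0 v)) \<and>
    (\<forall>e\<in>arcs E. \<phi> (lpa_edge K E e) = lpa_edge K E (\<sigma>1 e)) \<and>
    (\<forall>e\<in>arcs E. \<phi> (lpa_ghost K E e) = lpa_ghost K E (\<sigma>1 e)) \<and>
    (finite (verts E) \<longrightarrow>
      unital_map (leavitt_path_algebra K E) (leavitt_path_algebra K E) \<phi>)"
  using graded_algebra_automorphism_lpa_map[OF assms, of K] unital_lpa_map[OF assms, of K]
  by (intro exI[of _ "lpa_map E \<sigma>0 \<sigma>1"])
    (simp add: lpa_vertex_def lpa_edge_def lpa_ghost_def lpa_map_class[OF assms])

end
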